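(* Let $m \geq 2$, let $\mu \in \mathbb{R}\setminus\{0\}$, and let $D \subset \mathbb{R}^m$ be a bounded domain such that for every continuous function $f$ on $\partial D$ there exists $v \in C^2(D)\cap C^0(\overline D)$ with $\nabla^2 v - \mu^2 v = 0$ in $D$ and $v = f$ on $\partial D$. Let $u \in C^2(D)\cap C^0(\overline D)$ be real-valued, and let $r_* > 0$ be such that $D_{r_*} \neq \emptyset$. If $M^\circ(u,\cdot,r)$ is $\mu$-panharmonic in $D_r$ for all $r \in (0,r_* )$, then $u$ is $\mu$-panharmonic in $D$.
   Context: A domain is a connected open set. A real-valued $C^2$ function $w$ on an open set is called $\mu$-panharmonic there if $\nabla^2 w - \mu^2 w = 0$. $B_r(x)$ is the open ball of radius $r$ centred at $x$, $S_r(x)=\partial B_r(x)$, and $D_r = \{x \in D : \overline{B_r(x)} \subset D\}$. For $x \in D_r$, $M^\circ(u,x,r) = |S_r|^{-1}\int_{S_r(x)} u(y)\,dS_y$ is the spherical mean, where $|S_r|$ is the area of the sphere of radius $r$. *)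

theory Defs
  imports "HOL-Analysis.Analysis"
begin

definition partial_deriv :: "'a::euclidean_space \<Rightarrow> ('a \<Rightarrow> real) \<Rightarrow> 'a \<Rightarrow> real" where
  "partial_deriv b f x = deriv (\<lambda>t. f (x + t *\<^sub>R b)) 0"

definition has_partial_at :: "'a::euclidean_space \<Rightarrow> ('a \<Rightarrow> real) \<Rightarrow> 'a \<Rightarrow> bool" where
  "has_partial_at b f x \<longleftrightarrow> (\<lambda>t. f (x + t *\<^sub>R b)) differentiable (at 0)"

(* Meant for open S: all derivatives are taken in the whole space, so on an open S only the
   values of f in S matter. *)
definition C2_on :: "'a::euclidean_space set \<Rightarrow> ('a \<Rightarrow> real) \<Rightarrow> bool" where
  "C2_on S f \<longleftrightarrow> continuous_on S f \<and>
     (\<forall>b\<in>Basis. (\<forall>x\<in>S. has_partial_at b f x) \<and> continuous_on S (partial_deriv b f)) \<and>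
     (\<forall>b\<in>Basis. \<forall>c\<in>Basis. (\<forall>x\<in>S. has_partial_at c (partial_deriv b f) x) \<and>
        continuous_on S (partial_deriv c (partial_deriv b f)))"

definition laplacian :: "('a::euclidean_space \<Rightarrow> real) \<Rightarrow> 'a \<Rightarrow> real" where
  "laplacian f x = (\<Sum>b\<in>Basis. partial_deriv b (partial_deriv b f) x)"

definition panharmonic :: "real \<Rightarrow> 'a::euclidean_space set \<Rightarrow> ('a \<Rightarrow> real) \<Rightarrow> bool" where
  "panharmonic \<mu> S w \<longleftrightarrow> C2_on S w \<and> (\<forall>x\<in>S. laplacian w x - \<mu>\<^sup>2 * w x = 0)"

(* Surface measure of the sphere of radius r > 0 about x, as in the polar coordinate formula:
   the area of a Borel set A of the sphere is DIM('a) / r times the Lebesgue measure of the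
   cone {x + t (a - x) | a \<in> A, 0 < t \<le> 1}, which is the preimage of A under the radial projection of
   the punctured closed ball to the sphere. It is carried by the sphere but defined on all
   Borel sets of the space. *)
definition sphere_measure :: "'a::euclidean_space \<Rightarrow> real \<Rightarrow> 'a measure" where
  "sphere_measure x r = scale_measure (ennreal (real DIM('a) / r))
     (distr (restrict_space lborel (cball x r - {x})) borel
        (\<lambda>y. x + (r / norm (y - x)) *\<^sub>R (y - x)))"

definition sphere_area :: "'a::euclidean_space \<Rightarrow> real \<Rightarrow> real" where
  "sphere_area x r = measure (sphere_measure x r) (sphere x r)"

definition spherical_mean :: "('a::euclidean_space \<Rightarrow> real) \<Rightarrow> 'a \<Rightarrow> real \<Rightarrow> real" where
  "spherical_mean u x r =
     inverse (sphere_area x r) * (LINT y:sphere x r|sphere_measure x r. u y)"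

definition inner_domain :: "'a::euclidean_space set \<Rightarrow> real \<Rightarrow> 'a set" where
  "inner_domain D r = {x \<in> D. cball x r \<subseteq> D}"

lemma emeasure_sphere_measure:
  fixes x :: "'a::euclidean_space"
  assumes A: "A \<in> sets borel"
  shows "emeasure (sphere_measure x r) A = ennreal (real DIM('a) / r) *
    emeasure lborel {y \<in> cball x r - {x}. x + (r / norm (y - x)) *\<^sub>R (y - x) \<in> A}"
proof -
  let ?p = "\<lambda>y. x + (r / norm (y - x)) *\<^sub>R (y - x)"
  have p: "?p \<in> borel_measurable (restrict_space lborel (cball x r - {x}))"
    by (rule measurable_restrict_space1) simp
  have B: "cball x r - {x} \<in> sets borel" by auto
  have e: "?p -` A \<inter> space (restrict_space lborel (cball x r - {x})) = {y \<in> cball x r - {x}. ?p y \<in> A}"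
    by (auto simp: space_restrict_space)
  have "emeasure (distr (restrict_space lborel (cball x r - {x})) borel ?p) A =
      emeasure (restrict_space lborel (cball x r - {x})) {y \<in> cball x r - {x}. ?p y \<in> A}"
    using emeasure_distr[OF p A] e by simp
  also have "\<dots> = emeasure lborel {y \<in> cball x r - {x}. ?p y \<in> A}"
    by (rule emeasure_restrict_space) (use B in auto)
  finally show ?thesis
    by (simp add: sphere_measure_def emeasure_scale_measure)
qed

lemma sphere_area_eq:
  fixes x :: "'a::euclidean_space"
  assumes r: "r > 0"
  shows "sphere_area x r = real DIM('a) * unit_ball_vol (real DIM('a)) * r ^ (DIM('a) - 1)"
proof -
  let ?n = "DIM('a)"
  have s: "{y \<in> cball x r - {x}. x + (r / norm (y - x)) *\<^sub>R (y - x) \<in> sphere x r} = cball x r - {x}"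
    using r by (auto simp: dist_norm)
  have c: "emeasure lborel (cball x r - {x}) = ennreal (unit_ball_vol (real ?n) * r ^ ?n)"
    using r by (subst emeasure_Diff) (auto simp: emeasure_cball)
  have "emeasure (sphere_measure x r) (sphere x r) =
      ennreal (real ?n / r) * ennreal (unit_ball_vol (real ?n) * r ^ ?n)"
    unfolding emeasure_sphere_measure[OF borel_closed[OF closed_sphere]] s c ..
  also have "\<dots> = ennreal (real ?n / r * (unit_ball_vol (real ?n) * r ^ ?n))"
    by (rule ennreal_mult[symmetric]) (use r in \<open>auto intro!: mult_nonneg_nonneg\<close>)
  finally have "emeasure (sphere_measure x r) (sphere x r) =
      ennreal (real ?n / r * (unit_ball_vol (real ?n) * r ^ ?n))" .
  moreover have "real ?n / r * (unit_ball_vol (real ?n) * r ^ ?n) =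
      real ?n * unit_ball_vol (real ?n) * r ^ (?n - 1)"
    using r by (simp add: power_eq_if[of r ?n])
  ultimately show ?thesis
    using r by (simp add: sphere_area_def measure_def unit_ball_vol_nonneg)
qed

end

theory Submission
  imports Defs
begin

text \<open>
  The operator \<open>L = \<Delta> - \<mu>\<^sup>2\<close> has constant coefficients, so it commutes with
  translations and hence with averaging over spheres of a fixed radius: for \<open>u\<close> of class
  \<open>C\<^sup>2\<close> one has \<open>L (M(u, \<cdot>, r)) = M(L u, \<cdot>, r)\<close>. By assumption the left-hand side
  vanishes for all small \<open>r\<close>, and as \<open>r \<rightarrow> 0\<close> the right-hand side tends to \<open>L u\<close>,
  because the means of a continuous function over shrinking spheres converge to its value at the
  centre. Hence \<open>L u = 0\<close> at every point of \<open>D\<close>.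

  Two facts carry this. The means of \<open>f\<close> about \<open>x\<close> are averages of translates of \<open>f\<close> with
  respect to one probability measure (\<open>spherical_mean_translate\<close>), and they are 1-Lipschitz for
  the supremum norm on the sphere (\<open>spherical_mean_close\<close>). The latter turns the uniform
  convergence of difference quotients on a compact sphere into differentiability of the mean
  (\<open>DERIV_spherical_mean\<close>), and continuity at a point into convergence of the means
  (\<open>spherical_mean_tendsto_center\<close>).
\<close>

section \<open>Spherical means as averages of translates\<close>

lemma sets_sphere_measure [simp, measurable_cong]:
  "sets (sphere_measure x r) = sets borel"
  by (simp add: sphere_measure_def)

lemma space_sphere_measure [simp]: "space (sphere_measure x r) = UNIV"
  using sets_eq_imp_space_eq[OF sets_sphere_measure[of x r]] by simp

lemma finite_measure_sphere_measure:
  fixes x :: "'a::euclidean_space"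
  shows "finite_measure (sphere_measure x r)"
proof (rule finite_measureI)
  have "emeasure lborel {y \<in> cball x r - {x}. x + (r / norm (y - x)) *\<^sub>R (y - x) \<in> UNIV}
          \<le> emeasure lborel (cball x r)"
    by (rule emeasure_mono) auto
  also have "\<dots> < \<infinity>" by (rule emeasure_lborel_cball_finite)
  finally show "emeasure (sphere_measure x r) (space (sphere_measure x r)) \<noteq> \<infinity>"
    by (simp add: emeasure_sphere_measure[OF borel_open[OF open_UNIV], simplified]
        ennreal_mult_eq_top_iff)
qed

lemma sphere_area_pos:
  fixes x :: "'a::euclidean_space"
  assumes "r > 0"
  shows "sphere_area x r > 0"
  using assms by (simp add: sphere_area_eq)

text \<open>Translation invariance of Lebesgue measure, carried over to the cones that define the
  surface measure.\<close>
lemma sphere_measure_translate: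
  fixes x :: "'a::euclidean_space"
  shows "sphere_measure x r = distr (sphere_measure 0 r) borel ((+) x)"
proof (rule measure_eqI)
  show "sets (sphere_measure x r) = sets (distr (sphere_measure 0 r) borel ((+) x))" by simp
  fix A assume "A \<in> sets (sphere_measure x r)"
  then have A: "A \<in> sets borel" by simp
  have A': "(+) x -` A \<in> sets borel"
    using measurable_sets[of "(+) x" borel borel A] A by simp
  let ?B = "{y \<in> cball x r - {x}. x + (r / norm (y - x)) *\<^sub>R (y - x) \<in> A}"
  have B: "?B \<in> sets borel" using A by measurable
  have pre: "(+) x -` ?B = {y \<in> cball 0 r - {0}. 0 + (r / norm (y - 0)) *\<^sub>R (y - 0) \<in> (+) x -` A}"
    by (auto simp: dist_norm)
  have "emeasure lborel ?B = emeasure (distr lborel borel ((+) x)) ?B"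
    by (simp add: lborel_distr_plus)
  also have "\<dots> = emeasure lborel ((+) x -` ?B)"
    using B by (subst emeasure_distr) auto
  finally show "emeasure (sphere_measure x r) A = emeasure (distr (sphere_measure 0 r) borel ((+) x)) A"
    using A A' by (simp only: emeasure_sphere_measure pre) (simp add: emeasure_distr emeasure_sphere_measure)
qed

lemma spherical_mean_translate:
  fixes x :: "'a::euclidean_space"
  assumes r: "r > 0" and f: "continuous_on (sphere x r) f"
  shows "spherical_mean f x r = spherical_mean (\<lambda>z. f (x + z)) 0 r"
proof -
  have m: "(\<lambda>y. indicator (sphere x r) y *\<^sub>R f y) \<in> borel_measurable borel"
    using f by (intro borel_measurable_continuous_on_indicator) auto
  have i: "indicator (sphere x r) (x + z) = (indicator (sphere 0 r) z :: real)" for z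
    by (auto simp: indicator_def dist_norm)
  have "(LINT y:sphere x r|sphere_measure x r. f y)
      = (LINT z|sphere_measure 0 r. indicator (sphere x r) (x + z) *\<^sub>R f (x + z))"
    unfolding set_lebesgue_integral_def
    by (subst sphere_measure_translate, subst integral_distr) (use m in auto)
  then show ?thesis
    using r by (simp add: spherical_mean_def set_lebesgue_integral_def i sphere_area_eq)
qed

lemma set_integrable_sphere:
  fixes f :: "'a::euclidean_space \<Rightarrow> real"
  assumes f: "continuous_on (sphere x r) f"
  shows "set_integrable (sphere_measure x r) (sphere x r) f"
proof -
  interpret finite_measure "sphere_measure x r" by (rule finite_measure_sphere_measure)
  obtain B where B: "\<And>y. y \<in> sphere x r \<Longrightarrow> norm (f y) \<le> B"
    using compact_imp_bounded[OF compact_continuous_image[OF f compact_sphere]]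
    unfolding bounded_iff by blast
  have "(\<lambda>y. indicator (sphere x r) y *\<^sub>R f y) \<in> borel_measurable borel"
    using f by (intro borel_measurable_continuous_on_indicator) auto
  then have m: "(\<lambda>y. indicator (sphere x r) y *\<^sub>R f y) \<in> borel_measurable (sphere_measure x r)"
    by (simp add: measurable_cong_sets[OF sets_sphere_measure refl])
  show ?thesis
    unfolding set_integrable_def
    by (rule integrable_const_bound[where B = "max 0 B", OF _ m])
       (use B in \<open>auto simp: indicator_def le_max_iff_disj\<close>)
qed

lemma spherical_mean_diff:
  assumes "continuous_on (sphere x r) f" "continuous_on (sphere x r) g"
  shows "spherical_mean (\<lambda>y. f y - g y) x r = spherical_mean f x r - spherical_mean g x r"
  using assms by (simp add: spherical_mean_def set_integral_diff set_integrable_sphere right_diff_distrib)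

lemma spherical_mean_divide:
  "spherical_mean (\<lambda>y. f y / c) x r = spherical_mean f x r / c"
  by (simp add: spherical_mean_def set_lebesgue_integral_def)

lemma spherical_mean_const:
  assumes "r > 0"
  shows "spherical_mean (\<lambda>y. c) x r = c"
  using sphere_area_pos[OF assms, of x]
  by (simp add: spherical_mean_def sphere_area_def set_lebesgue_integral_def)

lemma spherical_mean_mono:
  assumes "r > 0" "continuous_on (sphere x r) f" "continuous_on (sphere x r) g"
    and "\<And>y. y \<in> sphere x r \<Longrightarrow> f y \<le> g y"
  shows "spherical_mean f x r \<le> spherical_mean g x r"
  unfolding spherical_mean_def
  by (intro mult_left_mono set_integral_mono set_integrable_sphere)
     (use assms sphere_area_pos[of r x] in auto)

text \<open>The surface measure divided by the area is a probability measure, so uniform estimates on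
  the sphere pass to means.\<close>
lemma spherical_mean_close:
  assumes r: "r > 0" and f: "continuous_on (sphere x r) f" and g: "continuous_on (sphere x r) g"
    and le: "\<And>y. y \<in> sphere x r \<Longrightarrow> \<bar>f y - g y\<bar> \<le> e"
  shows "\<bar>spherical_mean f x r - spherical_mean g x r\<bar> \<le> e"
proof -
  have c: "continuous_on (sphere x r) (\<lambda>y. f y - g y)" using f g by (intro continuous_intros)
  have "spherical_mean (\<lambda>y. f y - g y) x r \<le> spherical_mean (\<lambda>y. e) x r"
    using le by (intro spherical_mean_mono r c continuous_intros) (auto simp: abs_le_iff)
  moreover have "spherical_mean (\<lambda>y. - e) x r \<le> spherical_mean (\<lambda>y. f y - g y) x r"
    using le by (intro spherical_mean_mono r c continuous_intros) (force simp: abs_le_iff)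
  ultimately show ?thesis
    by (simp add: spherical_mean_const[OF r] spherical_mean_diff[OF f g] abs_le_iff)
qed

lemma spherical_mean_tendsto_center:
  fixes x :: "'a::euclidean_space" and f :: "'a \<Rightarrow> real"
  assumes D: "open D" "x \<in> D" and f: "continuous_on D f"
  shows "((\<lambda>r. spherical_mean f x r) \<longlongrightarrow> f x) (at_right 0)"
proof (rule tendstoI)
  fix e :: real assume "e > 0"
  then have "e / 2 > 0" by simp
  obtain d1 where d1: "d1 > 0" "ball x d1 \<subseteq> D"
    using D open_contains_ball by blast
  obtain d2 where d2: "d2 > 0" "\<And>y. y \<in> D \<Longrightarrow> dist y x < d2 \<Longrightarrow> dist (f y) (f x) < e / 2"
    using f D(2) \<open>e / 2 > 0\<close> unfolding continuous_on_iff by blast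
  have "dist (spherical_mean f x r) (f x) < e" if r: "0 < r" "r < min d1 d2" for r
  proof -
    have sub: "sphere x r \<subseteq> D" using r d1 by (auto simp: subset_iff)
    have "\<bar>spherical_mean f x r - spherical_mean (\<lambda>y. f x) x r\<bar> \<le> e / 2"
    proof (rule spherical_mean_close[OF r(1) continuous_on_subset[OF f sub]])
      fix y assume "y \<in> sphere x r"
      then show "\<bar>f y - f x\<bar> \<le> e / 2"
        using d2(2)[of y] subsetD[OF sub, of y] r
        by (simp add: dist_commute dist_real_def abs_minus_commute)
    qed (rule continuous_on_const)
    then show ?thesis using \<open>e > 0\<close> by (simp add: spherical_mean_const[OF r(1)] dist_real_def)
  qed
  then show "\<forall>\<^sub>F r in at_right 0. dist (spherical_mean f x r) (f x) < e"
    unfolding eventually_at_right_field using d1 d2 by (intro exI[of _ "min d1 d2"]) auto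
qed

section \<open>Averaging commutes with partial derivatives\<close>

text \<open>A compact ball in an open set leaves some room around it: this is what allows its centre to be
  moved, and hence the mean to be differentiated.\<close>
lemma inner_domain_enlarge:
  fixes x :: "'a::euclidean_space"
  assumes "open D" "x \<in> inner_domain D r" "r \<ge> 0"
  obtains d where "d > 0" "cball x (r + d) \<subseteq> D"
proof -
  obtain e where e: "e > 0" "{y. infdist y (cball x r) \<le> e} \<subseteq> D"
    using compact_in_open_separated[of "cball x r" D] assms by (auto simp: inner_domain_def)
  have "infdist y (cball x r) \<le> e" if y: "y \<in> cball x (r + e)" for y
  proof (cases "dist x y \<le> r")
    case True then show ?thesis using e by simp
  next
    case False
    \<comment> \<open>Compare with the radial projection of \<open>y\<close> to the ball.\<close>
    let ?n = "norm (y - x)"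
    let ?z = "x + (r / ?n) *\<^sub>R (y - x)"
    have n: "?n > r" "?n > 0" using False assms(3) by (auto simp: dist_norm norm_minus_commute)
    have z: "?z \<in> cball x r" using n assms(3) by (simp add: dist_norm)
    have "y - ?z = (1 - r / ?n) *\<^sub>R (y - x)" by (simp add: algebra_simps)
    then have "dist y ?z = \<bar>1 - r / ?n\<bar> * ?n" by (simp add: dist_norm)
    also have "\<dots> = ?n - r" using n by (simp add: field_simps)
    also have "\<dots> \<le> e" using y by (simp add: dist_norm norm_minus_commute)
    finally show ?thesis using infdist_le2[OF z] by blast
  qed
  then have "cball x (r + e) \<subseteq> D" using e(2) by blast
  then show ?thesis using that e(1) by blast
qed

lemma DERIV_along_line:
  assumes "has_partial_at b f (z + s *\<^sub>R b)"
  shows "((\<lambda>t. f (z + t *\<^sub>R b)) has_real_derivative partial_deriv b f (z + s *\<^sub>R b)) (at s)"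
proof -
  let ?h = "\<lambda>t. f (z + s *\<^sub>R b + t *\<^sub>R b)"
  have "(?h has_real_derivative partial_deriv b f (z + s *\<^sub>R b)) (at 0)"
    using assms unfolding has_partial_at_def partial_deriv_def
    by (simp add: DERIV_deriv_iff_real_differentiable)
  then have "((\<lambda>t. ?h (t - s)) has_real_derivative partial_deriv b f (z + s *\<^sub>R b)) (at s)"
    using DERIV_shift[of "\<lambda>t. ?h (t - s)" _ 0 s] by simp
  then show ?thesis by (simp add: algebra_simps)
qed

text \<open>On a slightly larger compact ball the partial derivative is uniformly continuous; by the mean
  value theorem the difference quotients then converge to it uniformly on the sphere, and uniform
  estimates survive averaging.\<close>
lemma DERIV_spherical_mean:
  fixes x b :: "'a::euclidean_space" and f :: "'a \<Rightarrow> real"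
  assumes D: "open D" and x: "x \<in> inner_domain D r" and r: "r > 0" and b: "b \<in> Basis"
    and f: "continuous_on D f" and p: "\<And>y. y \<in> D \<Longrightarrow> has_partial_at b f y"
    and g: "continuous_on D (partial_deriv b f)"
  shows "((\<lambda>t. spherical_mean f (x + t *\<^sub>R b) r) has_real_derivative
           spherical_mean (partial_deriv b f) x r) (at 0)"
proof -
  let ?g = "partial_deriv b f"
  obtain d where d: "d > 0" "cball x (r + d) \<subseteq> D"
    using inner_domain_enlarge[OF D x] r by auto
  have nb: "norm b = 1" using b by simp
  have near: "x + z + s *\<^sub>R b \<in> cball x (r + d)" if "z \<in> sphere 0 r" "\<bar>s\<bar> \<le> d" for z s
    using norm_triangle_ineq4[of "- z" "s *\<^sub>R b"] that nb by (simp add: dist_norm)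
  have nearD: "x + z + s *\<^sub>R b \<in> D" if "z \<in> sphere 0 r" "\<bar>s\<bar> \<le> d" for z s
    using near[OF that] d(2) by blast
  have cont: "continuous_on (sphere 0 r) (\<lambda>z. h (x + s *\<^sub>R b + z))"
    if "\<bar>s\<bar> \<le> d" "continuous_on D h" for h :: "'a \<Rightarrow> real" and s
    by (rule continuous_on_compose2[OF that(2)])
       (use nearD[OF _ that(1)] in \<open>auto intro!: continuous_intros simp: algebra_simps\<close>)
  have mean: "spherical_mean h (x + s *\<^sub>R b) r = spherical_mean (\<lambda>z. h (x + s *\<^sub>R b + z)) 0 r"
    if "\<bar>s\<bar> \<le> d" "continuous_on D h" for h :: "'a \<Rightarrow> real" and s
  proof (rule spherical_mean_translate[OF r])
    have "y \<in> D" if "y \<in> sphere (x + s *\<^sub>R b) r" for y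
      using nearD[of "y - (x + s *\<^sub>R b)" s] that \<open>\<bar>s\<bar> \<le> d\<close>
      by (simp add: dist_norm norm_minus_commute algebra_simps)
    then show "continuous_on (sphere (x + s *\<^sub>R b) r) h"
      using that(2) continuous_on_subset by blast
  qed
  have quot: "\<exists>\<delta>>0. \<forall>t. t \<noteq> 0 \<longrightarrow> \<bar>t\<bar> < \<delta> \<longrightarrow>
      \<bar>(spherical_mean f (x + t *\<^sub>R b) r - spherical_mean f x r) / t - spherical_mean ?g x r\<bar> \<le> e"
    if e: "e > 0" for e
  proof -
    have "uniformly_continuous_on (cball x (r + d)) ?g"
      using continuous_on_subset[OF g d(2)] by (intro compact_uniformly_continuous) auto
    then obtain \<delta>0 where \<delta>0: "\<delta>0 > 0"
      "\<And>y y'. y \<in> cball x (r + d) \<Longrightarrow> y' \<in> cball x (r + d) \<Longrightarrow> dist y' y < \<delta>0 \<Longrightarrow> dist (?g y') (?g y) < e"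
      unfolding uniformly_continuous_on_def using e by meson
    let ?\<delta> = "min d \<delta>0"
    have "\<bar>(spherical_mean f (x + t *\<^sub>R b) r - spherical_mean f x r) / t - spherical_mean ?g x r\<bar> \<le> e"
      if t: "t \<noteq> 0" "\<bar>t\<bar> < ?\<delta>" for t
    proof -
      have td: "\<bar>t\<bar> \<le> d" using t by simp
      let ?q = "\<lambda>z. (f (x + t *\<^sub>R b + z) - f (x + z)) / t"
      have cf: "continuous_on (sphere 0 r) (\<lambda>z. f (x + t *\<^sub>R b + z))" by (rule cont[OF td f])
      have cf0: "continuous_on (sphere 0 r) (\<lambda>z. f (x + z))" using cont[of 0 f] d f by simp
      have cg: "continuous_on (sphere 0 r) (\<lambda>z. ?g (x + z))" using cont[of 0 ?g] d g by simp
      have pt: "\<bar>?q z - ?g (x + z)\<bar> \<le> e" if z: "z \<in> sphere 0 r" for z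
      proof -
        have dv: "((\<lambda>s. f (x + z + s *\<^sub>R b)) has_real_derivative ?g (x + z + s *\<^sub>R b)) (at s)"
          if "\<bar>s\<bar> \<le> d" for s
          by (rule DERIV_along_line) (rule p[OF nearD[OF z that]])
        obtain s where s: "\<bar>s\<bar> \<le> \<bar>t\<bar>" "f (x + z + t *\<^sub>R b) - f (x + z) = t * ?g (x + z + s *\<^sub>R b)"
        proof (cases "t > 0")
          case True
          then have "\<exists>s. 0 < s \<and> s < t \<and> f (x + z + t *\<^sub>R b) - f (x + z + 0 *\<^sub>R b)
                        = (t - 0) * ?g (x + z + s *\<^sub>R b)"
            using td by (intro MVT2[of 0 t "\<lambda>s. f (x + z + s *\<^sub>R b)"] dv) auto
          then obtain s where "0 < s" "s < t" "f (x + z + t *\<^sub>R b) - f (x + z) = t * ?g (x + z + s *\<^sub>R b)"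
            by auto
          then show ?thesis by (intro that[of s]) auto
        next
          case False
          then have "t < 0" using t by simp
          then have "\<exists>s. t < s \<and> s < 0 \<and> f (x + z + 0 *\<^sub>R b) - f (x + z + t *\<^sub>R b)
                        = (0 - t) * ?g (x + z + s *\<^sub>R b)"
            using td by (intro MVT2[of t 0 "\<lambda>s. f (x + z + s *\<^sub>R b)"] dv) auto
          then obtain s where "t < s" "s < 0" "f (x + z) - f (x + z + t *\<^sub>R b) = - t * ?g (x + z + s *\<^sub>R b)"
            by auto
          then show ?thesis by (intro that[of s]) auto
        qed
        have sd: "\<bar>s\<bar> \<le> d" using s(1) td by simp
        have "dist (?g (x + z + s *\<^sub>R b)) (?g (x + z + 0 *\<^sub>R b)) < e"
          using d(1) s(1) t(2) nb by (intro \<delta>0(2) near z sd) (auto simp: dist_norm)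
        moreover have "?q z = ?g (x + z + s *\<^sub>R b)"
          using s(2) t(1) by (simp add: algebra_simps)
        ultimately show ?thesis by (simp add: dist_real_def)
      qed
      have "spherical_mean ?q 0 r = (spherical_mean f (x + t *\<^sub>R b) r - spherical_mean f x r) / t"
        using mean[OF td f] mean[of 0 f] d f
        by (simp add: spherical_mean_divide spherical_mean_diff[OF cf cf0])
      moreover have "spherical_mean (\<lambda>z. ?g (x + z)) 0 r = spherical_mean ?g x r"
        using mean[of 0 ?g] d g by simp
      moreover have "\<bar>spherical_mean ?q 0 r - spherical_mean (\<lambda>z. ?g (x + z)) 0 r\<bar> \<le> e"
        by (intro spherical_mean_close r pt cg) (use cf cf0 t in \<open>auto intro!: continuous_intros\<close>)
      ultimately show ?thesis by simp
    qed
    then show ?thesis using d(1) \<delta>0(1) by (intro exI[of _ ?\<delta>]) auto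
  qed
  show ?thesis
    unfolding DERIV_def
  proof (rule LIM_I)
    fix e :: real assume "e > 0"
    then have "e / 2 > 0" by simp
    from quot[OF this] obtain \<delta> where "\<delta> > 0" "\<And>t. t \<noteq> 0 \<Longrightarrow> \<bar>t\<bar> < \<delta> \<Longrightarrow>
      \<bar>(spherical_mean f (x + t *\<^sub>R b) r - spherical_mean f x r) / t - spherical_mean ?g x r\<bar> \<le> e / 2"
      by blast
    then show "\<exists>s>0. \<forall>t. t \<noteq> 0 \<and> norm (t - 0) < s \<longrightarrow>
        norm ((spherical_mean f (x + (0 + t) *\<^sub>R b) r - spherical_mean f (x + 0 *\<^sub>R b) r) / t
          - spherical_mean ?g x r) < e"
      using \<open>e > 0\<close> by (intro exI[of _ \<delta>]) (force dest: le_less_trans)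
  qed
qed

lemma partial_deriv_spherical_mean:
  assumes "open D" "x \<in> inner_domain D r" "r > 0" "b \<in> Basis" "continuous_on D f"
    "\<And>y. y \<in> D \<Longrightarrow> has_partial_at b f y" "continuous_on D (partial_deriv b f)"
  shows "partial_deriv b (\<lambda>x. spherical_mean f x r) x = spherical_mean (partial_deriv b f) x r"
  unfolding partial_deriv_def[of b "\<lambda>x. spherical_mean f x r"]
  by (rule DERIV_imp_deriv) (rule DERIV_spherical_mean[OF assms])

lemma eventually_inner_domain_line:
  fixes x b :: "'a::euclidean_space"
  assumes "open D" "x \<in> inner_domain D r" "r \<ge> 0" "b \<in> Basis"
  shows "\<forall>\<^sub>F t in nhds 0. x + t *\<^sub>R b \<in> inner_domain D r"
proof -
  obtain d where d: "d > 0" "cball x (r + d) \<subseteq> D"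
    using inner_domain_enlarge[OF assms(1-3)] .
  have "x + t *\<^sub>R b \<in> inner_domain D r" if "\<bar>t\<bar> < d" for t
  proof -
    have "cball (x + t *\<^sub>R b) r \<subseteq> cball x (r + d)"
      using that assms(4) by (intro cball_subset_cball_iff[THEN iffD2]) (simp add: dist_norm)
    moreover have "x + t *\<^sub>R b \<in> cball (x + t *\<^sub>R b) r" using assms(3) by simp
    ultimately show ?thesis using d(2) unfolding inner_domain_def by blast
  qed
  then show ?thesis
    unfolding eventually_nhds_metric using d(1) by (intro exI[of _ d]) (auto simp: dist_real_def)
qed

text \<open>The formula for the first derivative holds at all points of the line near \<open>x\<close>, not only at
  \<open>x\<close>, so it can be differentiated once more, now with \<open>\<partial>\<^sub>b f\<close> in place of \<open>f\<close>.\<close>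
lemma partial_deriv_partial_deriv_spherical_mean:
  fixes x b :: "'a::euclidean_space"
  assumes D: "open D" "x \<in> inner_domain D r" "r > 0" and b: "b \<in> Basis" and f: "C2_on D f"
  shows "partial_deriv b (partial_deriv b (\<lambda>x. spherical_mean f x r)) x
           = spherical_mean (partial_deriv b (partial_deriv b f)) x r"
proof -
  have f': "continuous_on D f" "\<And>y. y \<in> D \<Longrightarrow> has_partial_at b f y"
    "continuous_on D (partial_deriv b f)" "\<And>y. y \<in> D \<Longrightarrow> has_partial_at b (partial_deriv b f) y"
    "continuous_on D (partial_deriv b (partial_deriv b f))"
    using f b unfolding C2_on_def by auto
  have "\<forall>\<^sub>F t in nhds 0. partial_deriv b (\<lambda>x. spherical_mean f x r) (x + t *\<^sub>R b)
          = spherical_mean (partial_deriv b f) (x + t *\<^sub>R b) r"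
    using eventually_inner_domain_line[OF D(1,2) less_imp_le[OF D(3)] b]
    by eventually_elim (rule partial_deriv_spherical_mean[OF D(1) _ D(3) b f'(1-3)])
  then have "partial_deriv b (partial_deriv b (\<lambda>x. spherical_mean f x r)) x
      = partial_deriv b (\<lambda>x. spherical_mean (partial_deriv b f) x r) x"
    unfolding partial_deriv_def[of b "partial_deriv b (\<lambda>x. spherical_mean f x r)"]
      partial_deriv_def[of b "\<lambda>x. spherical_mean (partial_deriv b f) x r"]
    by (intro deriv_cong_ev) auto
  also have "\<dots> = spherical_mean (partial_deriv b (partial_deriv b f)) x r"
    by (rule partial_deriv_spherical_mean[OF D b f'(3-5)])
  finally show ?thesis .
qed

section \<open>The limit of small radii\<close>

theorem theorem3p4:
  fixes D :: "(real ^ 'm) set" and u :: "real ^ 'm \<Rightarrow> real" and \<mu> r_star :: real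
  assumes "CARD('m) \<ge> 2"
    and "\<mu> \<noteq> 0"
    and "open D" and "connected D" and "bounded D"
    and "\<And>f :: real ^ 'm \<Rightarrow> real. continuous_on (frontier D) f \<Longrightarrow>
           \<exists>v. C2_on D v \<and> continuous_on (closure D) v \<and>
               (\<forall>x\<in>D. laplacian v x - \<mu>\<^sup>2 * v x = 0) \<and> (\<forall>x\<in>frontier D. v x = f x)"
    and "C2_on D u" and "continuous_on (closure D) u"
    and "r_star > 0" and "inner_domain D r_star \<noteq> {}"
    and "\<And>r. 0 < r \<Longrightarrow> r < r_star \<Longrightarrow>
           panharmonic \<mu> (inner_domain D r) (\<lambda>x. spherical_mean u x r)"
  shows "panharmonic \<mu> D u"
proof -
  note D = \<open>open D\<close> and u = \<open>C2_on D u\<close>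
  have "laplacian u x - \<mu>\<^sup>2 * u x = 0" if x: "x \<in> D" for x
  proof -
    let ?Lmean = "\<lambda>r. (\<Sum>b\<in>Basis. spherical_mean (partial_deriv b (partial_deriv b u)) x r)
                        - \<mu>\<^sup>2 * spherical_mean u x r"
    obtain d where d: "d > 0" "cball x d \<subseteq> D"
      using D x open_contains_cball by blast
    have zero: "?Lmean r = 0" if r: "0 < r" "r < min d r_star" for r
    proof -
      have xr: "x \<in> inner_domain D r" using d r by (auto simp: inner_domain_def)
      then have "laplacian (\<lambda>x. spherical_mean u x r) x - \<mu>\<^sup>2 * spherical_mean u x r = 0"
        using assms(11)[of r] r by (auto simp: panharmonic_def)
      then show ?thesis
        by (simp add: laplacian_def partial_deriv_partial_deriv_spherical_mean[OF D xr r(1) _ u])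
    qed
    have "(?Lmean \<longlongrightarrow> (\<Sum>b\<in>Basis. partial_deriv b (partial_deriv b u) x) - \<mu>\<^sup>2 * u x) (at_right 0)"
      by (intro tendsto_intros spherical_mean_tendsto_center[OF D x])
         (use u in \<open>auto simp: C2_on_def\<close>)
    moreover have "\<forall>\<^sub>F r in at_right 0. ?Lmean r = 0"
      unfolding eventually_at_right_field
      using zero d \<open>r_star > 0\<close> by (intro exI[of _ "min d r_star"]) auto
    then have "(?Lmean \<longlongrightarrow> 0) (at_right 0)" by (rule tendsto_eventually)
    ultimately have "(\<Sum>b\<in>Basis. partial_deriv b (partial_deriv b u) x) - \<mu>\<^sup>2 * u x = 0"
      by (rule tendsto_unique[OF trivial_limit_at_right_real])
    then show ?thesis by (simp add: laplacian_def)
  qed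
  then show ?thesis using u by (simp add: panharmonic_def)
qed

end
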